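(* Let $q\in(0,1)$ and let $1\le n\le m$ be integers. The unique stationary distribution $\pi_{m,n,q}$ of the bounded geometric juggler's exclusion process with $n$ particles, $m$ admissible heights and parameter $q$ is given by $$\pi_{m,n,q}(B)=Z^{-1}\prod_{x\in B}\Bigl([\,1+v_B(x)\,]_q\;q^x\Bigr)\qquad\text{for every } B\subset\{0,\ldots,m-1\}\text{ with }|B|=n,$$ where $v_B(x)=\bigl|\{x,\ldots,m-1\}\setminus B\bigr|$ and $$Z=Z(m,n,q)=q^{-n+\binom{m+1}{2}}\,S_{1/q}[m+1,m-n+1].$$
   Context: For $r>0$, $r\ne1$ and an integer $k\ge0$, $[k]_r=(1-r^k)/(1-r)$. The $q$-Stirling numbers of the second kind $S_r[a,b]$ are defined by $S_r[0,0]=1$, $S_r[a,b]=0$ for $b<0$ or $b>a$, and $S_r[a+1,b]=r^{b-1}S_r[a,b-1]+[b]_rS_r[a,b]$ for $0\le b\le a+1$; $S_{1/q}$ means $r=1/q$. $\mathbb{Z}_+=\{0,1,2,\ldots\}$. For a finite set $A\subset\mathbb{Z}_+$, $\theta_A$ denotes the order-preserving bijection from $\mathbb{Z}_+$ onto $\mathbb{Z}_+\setminus A$. For a set $X$ of integers, $X-1=\{x-1:x\in X\}$. The bounded geometric juggler's exclusion process (JEP) with $n$ particles, $m\ge n$ admissible heights and parameter $q\in(0,1)$ is the Markov chain $(X_t)_{t\ge0}$ on the $n$-element subsets of $\{0,\ldots,m-1\}$ with the following dynamics. If $0\notin X_t$, then $X_{t+1}=X_t-1$. If $0\in X_t$,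 put $X_t^*=(X_t\setminus\{0\})-1$; then $X_{t+1}=X_t^*\cup\{\theta_{X_t^*}(\xi_t)\}$, where the $\xi_t$ are independent random integers (independent of $X_0$) with the truncated geometric distribution $\mathrm{P}(\xi_t=x)=\frac{1-q}{1-q^{\ell}}q^x$ for $x\in\{0,\ldots,\ell-1\}$, with $\ell=m-n+1$. This chain is known to be ergodic, with a unique stationary distribution, denoted $\pi_{m,n,q}$. *)

theory Defs
  imports "HOL-Probability.Probability_Mass_Function" "HOL-Library.Infinite_Set"
begin

definition qnum :: "real \<Rightarrow> nat \<Rightarrow> real" where
  "qnum r k = (1 - r ^ k) / (1 - r)"

(* The values S_r[a,b] with b < 0 are 0, so they are left out of the domain: this removes the
   term r^(b-1) S_r[a,b-1] from the recurrence at b = 0. Vanishing for b > a follows from the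
   recurrence, see qStirling_eq_0. *)
fun qStirling :: "real \<Rightarrow> nat \<Rightarrow> nat \<Rightarrow> real" where
  "qStirling r 0 0 = 1"
| "qStirling r 0 (Suc b) = 0"
| "qStirling r (Suc a) 0 = qnum r 0 * qStirling r a 0"
| "qStirling r (Suc a) (Suc b) =
     r ^ b * qStirling r a b + qnum r (Suc b) * qStirling r a (Suc b)"

lemma qStirling_eq_0: "a < b \<Longrightarrow> qStirling r a b = 0"
  by (induction r a b rule: qStirling.induct) auto

definition trunc_geom_pmf :: "real \<Rightarrow> nat \<Rightarrow> nat pmf" where
  "trunc_geom_pmf q l =
     embed_pmf (\<lambda>x. if x < l then (1 - q) / (1 - q ^ l) * q ^ x else 0)"

(* For these parameters the function passed to embed_pmf is a probability mass function. *)
lemma pmf_trunc_geom: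
  assumes "0 < q" "q < 1" "0 < l"
  shows "pmf (trunc_geom_pmf q l) x = (if x < l then (1 - q) / (1 - q ^ l) * q ^ x else 0)"
proof -
  let ?f = "\<lambda>x. if x < l then (1 - q) / (1 - q ^ l) * q ^ x else 0"
  have less: "q ^ l < 1"
    using assms by (simp add: power_less_one_iff)
  have nonneg: "0 \<le> ?f x" for x
    using assms less by simp
  have "(\<Sum>x<l. ?f x) = (1 - q) / (1 - q ^ l) * (\<Sum>x<l. q ^ x)"
    by (simp add: sum_distrib_left)
  also have "\<dots> = 1"
    using assms less by (simp add: sum_gp_strict)
  finally have sum1: "(\<Sum>x<l. ?f x) = 1" .
  have "(\<integral>\<^sup>+ x. ennreal (?f x) \<partial>count_space UNIV) = (\<Sum>x<l. ennreal (?f x))"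
    by (rule nn_integral_count_space'[of "{..<l}"]) auto
  also have "\<dots> = ennreal (\<Sum>x<l. ?f x)"
    by (rule sum_ennreal) (rule nonneg)
  also have "\<dots> = 1"
    using sum1 by simp
  finally have total: "(\<integral>\<^sup>+ x. ennreal (?f x) \<partial>count_space UNIV) = 1" .
  show ?thesis
    unfolding trunc_geom_pmf_def by (rule pmf_embed_pmf[OF nonneg total])
qed

(* For finite A the complement is infinite, and enumerate lists it in increasing order. *)
definition theta :: "nat set \<Rightarrow> nat \<Rightarrow> nat" where
  "theta A = enumerate (- A)"

lemma theta_strict_mono: "finite A \<Longrightarrow> strict_mono (theta A)"
  unfolding theta_def by (simp add: strict_mono_enumerate Compl_eq_Diff_UNIV)

lemma theta_bij: "finite A \<Longrightarrow> bij_betw (theta A) UNIV (- A)"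
  unfolding theta_def by (simp add: bij_enumerate Compl_eq_Diff_UNIV)

(* The set X - 1; only used for sets not containing 0, where nat subtraction is exact. *)
definition shift_down :: "nat set \<Rightarrow> nat set" where
  "shift_down X = (\<lambda>x. x - 1) ` X"

definition jep_update :: "nat set \<Rightarrow> nat \<Rightarrow> nat set" where
  "jep_update X \<xi> =
     (if 0 \<notin> X then shift_down X
      else let Y = shift_down (X - {0}) in Y \<union> {theta Y \<xi>})"

definition jep_states :: "nat \<Rightarrow> nat \<Rightarrow> nat set set" where
  "jep_states m n = {B. B \<subseteq> {0..<m} \<and> card B = n}"

definition jep_kernel :: "nat \<Rightarrow> nat \<Rightarrow> real \<Rightarrow> nat set \<Rightarrow> nat set pmf" where
  "jep_kernel m n q X = map_pmf (jep_update X) (trunc_geom_pmf q (m - n + 1))"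

definition jep_stationary :: "nat \<Rightarrow> nat \<Rightarrow> real \<Rightarrow> nat set pmf \<Rightarrow> bool" where
  "jep_stationary m n q p \<longleftrightarrow>
     set_pmf p \<subseteq> jep_states m n \<and> bind_pmf p (jep_kernel m n q) = p"

definition jep_pi :: "nat \<Rightarrow> nat \<Rightarrow> real \<Rightarrow> nat set pmf" where
  "jep_pi m n q = (THE p. jep_stationary m n q p)"

definition jep_v :: "nat \<Rightarrow> nat set \<Rightarrow> nat \<Rightarrow> nat" where
  "jep_v m B x = card ({x..<m} - B)"

definition jep_Z :: "nat \<Rightarrow> nat \<Rightarrow> real \<Rightarrow> real" where
  "jep_Z m n q =
     q powi (- int n + int ((m + 1) choose 2)) * qStirling (1 / q) (m + 1) (m - n + 1)"

end

(* Write w_m(B) for the product over B and B + 1 for the shifted set. Splitting off the factor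
   at 0 gives w_(m+1)(B + 1) = q^|B| w_m(B) and
   w_(m+1)({0} \<union> (B + 1)) = [m + 1 - |B|]_q q^|B| w_m(B). This recursion sums to the one for
   S_(1/q), which yields Z. Applied to the predecessors B + 1 and {0} \<union> ((B - {b}) + 1), b \<in> B,
   of a state B it turns the balance equation into an identity proved by induction on m, using
   [k + 1]_q = 1 + q [k]_q.

   Uniqueness: a draw of 0 strictly lowers the sum of the positions unless the state is
   {0..<n}, so {0..<n} is reachable from everywhere. For stationary p and p' the signed measure
   h = p'(s) p - p(s) p' with s = {0..<n} is invariant, hence |h| is subinvariant and, having the
   same total mass as its image, invariant. It vanishes at s, so it vanishes at all states. *)
theory Submission
  imports Defs
begin

section \<open>Weights and their behaviour under shifting all heights by one\<close>

definition jep_weight :: "real \<Rightarrow> nat \<Rightarrow> nat set \<Rightarrow> real" where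
  "jep_weight q m B = (\<Prod>x\<in>B. qnum q (1 + jep_v m B x) * q ^ x)"

lemma qnum_Suc: "r \<noteq> 1 \<Longrightarrow> qnum r (Suc k) = 1 + r * qnum r k"
  by (simp add: qnum_def field_simps)

lemma qnum_pos: "0 < q \<Longrightarrow> q < 1 \<Longrightarrow> 0 < k \<Longrightarrow> 0 < qnum q k"
  by (simp add: qnum_def power_less_one_iff)

text \<open>Reversing the geometric sum \<open>1 + ... + q ^ k\<close>. This converts the parameter
  \<open>1 / q\<close> of the Stirling numbers into the \<open>q\<close> of the weights.\<close>

lemma qnum_inverse:
  assumes "0 < q" "q < 1"
  shows "q ^ k * qnum (1 / q) (Suc k) = qnum q (Suc k)"
  using assms by (simp add: qnum_def field_simps)

lemma Suc_image_or_insert_0: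
  fixes B :: "nat set"
  obtains C where "B = Suc ` C" | C where "B = insert 0 (Suc ` C)"
proof (cases "0 \<in> B")
  case True
  then have "B = insert 0 (Suc ` (Suc -` B))"
    by - (rule set_eqI, rename_tac y, case_tac y; simp add: inj_image_mem_iff)
  then show ?thesis using that by blast
next
  case False
  then have "B = Suc ` (Suc -` B)"
    by - (rule set_eqI, rename_tac y, case_tac y; simp add: inj_image_mem_iff)
  then show ?thesis using that by blast
qed

text \<open>The heights from \<open>Suc x\<close> upwards are a shifted copy of those from
  \<open>x\<close> upwards, gaps included; a particle at 0 lies below all of them.\<close>

lemma jep_v_Suc:
  "jep_v (Suc m) (Suc ` B) (Suc x) = jep_v m B x"
  "jep_v (Suc m) (insert 0 (Suc ` B)) (Suc x) = jep_v m B x"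
proof -
  have "{Suc x..<Suc m} - Suc ` B = Suc ` ({x..<m} - B)"
    "{Suc x..<Suc m} - insert 0 (Suc ` B) = Suc ` ({x..<m} - B)"
    by (rule set_eqI, rename_tac y, case_tac y; auto simp: inj_image_mem_iff)+
  then show "jep_v (Suc m) (Suc ` B) (Suc x) = jep_v m B x"
    "jep_v (Suc m) (insert 0 (Suc ` B)) (Suc x) = jep_v m B x"
    unfolding jep_v_def by (simp_all only: card_image[OF inj_on_subset[OF inj_Suc subset_UNIV]])
qed

lemma jep_weight_Suc_image:
  "jep_weight q (Suc m) (Suc ` B) = q ^ card B * jep_weight q m B"
  by (simp add: jep_weight_def prod.reindex jep_v_Suc prod.distrib algebra_simps)

text \<open>The particle at 0 has \<open>q ^ 0 = 1\<close> and sees all \<open>m - card B\<close>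
  gaps, whence the \<open>qnum\<close> factor; every other particle gains one \<open>q\<close> from
  the shift.\<close>

lemma jep_weight_insert_0:
  assumes "B \<subseteq> {0..<m}"
  shows "jep_weight q (Suc m) (insert 0 (Suc ` B)) =
    qnum q (Suc (m - card B)) * q ^ card B * jep_weight q m B"
proof -
  have fin: "finite B" using assms finite_subset by blast
  have "{0..<Suc m} - insert 0 (Suc ` B) = Suc ` ({0..<m} - B)"
    by (rule set_eqI, rename_tac y, case_tac y; auto simp: inj_image_mem_iff)
  then have "jep_v (Suc m) (insert 0 (Suc ` B)) 0 = m - card B"
    unfolding jep_v_def by (simp add: card_image card_Diff_subset fin assms)
  then show ?thesis using fin
    by (simp add: jep_weight_def prod.reindex jep_v_Suc prod.distrib algebra_simps)
qed

lemma jep_weight_pos: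
  assumes "0 < q" "q < 1"
  shows "0 < jep_weight q m B"
  unfolding jep_weight_def using assms by (intro prod_pos) (auto intro!: mult_pos_pos qnum_pos)

section \<open>Splitting the states by the occupation of 0\<close>

lemma finite_jep_states: "finite (jep_states m n)"
  unfolding jep_states_def by (rule finite_subset[of _ "Pow {0..<m}"]) auto

lemma jep_states_finite: "B \<in> jep_states m n \<Longrightarrow> finite B"
  unfolding jep_states_def by (auto intro: finite_subset)

lemma Suc_image_subset: "Suc ` B \<subseteq> {0..<Suc m} \<longleftrightarrow> B \<subseteq> {0..<m}"
  by auto

lemma inj_image_Suc: "inj_on ((`) Suc) A"
  by (auto simp: inj_on_def inj_image_eq_iff)

lemma inj_insert_0_Suc: "inj_on (\<lambda>C. insert 0 (Suc ` C)) A"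
proof (rule inj_onI)
  fix C D assume "insert 0 (Suc ` C) = insert 0 (Suc ` D)"
  then have "Suc ` C = Suc ` D" by blast
  then show "C = D" by (simp add: inj_image_eq_iff)
qed

lemma jep_states_Suc:
  "jep_states (Suc m) (Suc n) =
    (`) Suc ` jep_states m (Suc n) \<union> (\<lambda>C. insert 0 (Suc ` C)) ` jep_states m n"
proof (intro equalityI subsetI)
  fix B assume B: "B \<in> jep_states (Suc m) (Suc n)"
  then have fin: "finite B" by (rule jep_states_finite)
  show "B \<in> (`) Suc ` jep_states m (Suc n) \<union> (\<lambda>C. insert 0 (Suc ` C)) ` jep_states m n"
  proof (cases B rule: Suc_image_or_insert_0)
    case (1 C)
    then have "C \<in> jep_states m (Suc n)"
      using B by (simp add: jep_states_def card_image Suc_image_subset)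
    then show ?thesis using 1 by blast
  next
    case (2 C)
    then have "finite C" using fin by (auto dest: finite_imageD)
    then have "C \<in> jep_states m n"
      using B 2 by (auto simp: jep_states_def card_image)
    then show ?thesis using 2 by blast
  qed
next
  fix B assume "B \<in> (`) Suc ` jep_states m (Suc n) \<union> (\<lambda>C. insert 0 (Suc ` C)) ` jep_states m n"
  then consider C where "B = Suc ` C" "C \<in> jep_states m (Suc n)"
    | C where "B = insert 0 (Suc ` C)" "C \<in> jep_states m n"
    by blast
  then show "B \<in> jep_states (Suc m) (Suc n)"
  proof cases
    case 1
    then show ?thesis by (simp add: jep_states_def card_image Suc_image_subset)
  next
    case 2
    then show ?thesis
      using jep_states_finite[OF 2(2)] by (simp add: jep_states_def card_image Suc_image_subset)
  qed
qed

lemma jep_states_0: "jep_states m 0 = {{}}"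
  by (auto simp: jep_states_def dest: finite_subset)

lemma jep_states_empty: "m < n \<Longrightarrow> jep_states m n = {}"
  by (auto simp: jep_states_def dest: subset_eq_atLeast0_lessThan_card)

lemma sum_jep_states_Suc:
  "(\<Sum>X\<in>jep_states (Suc m) (Suc n). F X) =
    (\<Sum>C\<in>jep_states m (Suc n). F (Suc ` C)) + (\<Sum>C\<in>jep_states m n. F (insert 0 (Suc ` C)))"
  unfolding jep_states_Suc
  by (subst sum.union_disjoint)
    (auto simp: finite_jep_states sum.reindex inj_image_Suc inj_insert_0_Suc)

section \<open>The total weight and the q-Stirling numbers\<close>

lemma sum_jep_weight_Suc:
  "(\<Sum>B\<in>jep_states (Suc m) (Suc n). jep_weight q (Suc m) B) =
    q ^ Suc n * (\<Sum>B\<in>jep_states m (Suc n). jep_weight q m B) +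
    qnum q (Suc (m - n)) * q ^ n * (\<Sum>B\<in>jep_states m n. jep_weight q m B)"
  unfolding sum_jep_states_Suc sum_distrib_left
  by (intro arg_cong2[where f = "(+)"] sum.cong)
    (auto simp: jep_weight_Suc_image jep_weight_insert_0 jep_states_def)

text \<open>This is the q-Stirling recurrence at lower index \<open>m - n + 1\<close>, rescaled by
  powers of \<open>q\<close>; its coefficients are those of the recursion for the total
  weight.\<close>

lemma jep_Z_Suc:
  assumes "0 < q" "q < 1" "n \<le> m"
  shows "jep_Z (Suc m) (Suc n) q =
    (if n < m then q ^ Suc n * jep_Z m (Suc n) q else 0) + qnum q (Suc (m - n)) * q ^ n * jep_Z m n q"
proof -
  obtain k where m: "m = n + k" using assms(3) le_Suc_ex by blast
  define e where "e = q powi (- int n + int ((m + 1) choose 2))"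
  have ch: "(Suc (Suc m)) choose 2 = (Suc m choose 2) + Suc m"
    by (simp add: numeral_2_eq_2)
  have Z1: "jep_Z (Suc m) (Suc n) q = e * q ^ m * qStirling (1 / q) (Suc (Suc m)) (Suc k)"
  proof -
    have e: "- int (Suc n) + int ((Suc (Suc m)) choose 2) = (- int n + int ((m + 1) choose 2)) + int m"
      unfolding ch by simp
    then have "q powi (- int (Suc n) + int ((Suc (Suc m)) choose 2)) = e * q ^ m"
      unfolding e_def e using power_int_add[of q _ "int m"] assms(1) by (simp only: power_int_of_nat) simp
    moreover have "Suc m - Suc n + 1 = Suc k" using m by simp
    ultimately show ?thesis by (simp add: jep_Z_def del: binomial_Suc_Suc qStirling.simps)
  qed
  have Z2: "jep_Z m n q = e * qStirling (1 / q) (Suc m) (Suc k)"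
    using m by (simp add: jep_Z_def e_def del: qStirling.simps)
  have Z3: "q * jep_Z m (Suc n) q = e * qStirling (1 / q) (Suc m) k" if "n < m"
  proof -
    have "- int n + int ((m + 1) choose 2) = (- int (Suc n) + int ((m + 1) choose 2)) + 1"
      by simp
    then have "e = q powi (- int (Suc n) + int ((m + 1) choose 2)) * q"
      unfolding e_def using assms(1) by (metis power_int_add power_int_1_right less_irrefl)
    moreover have "m - Suc n + 1 = k" using that m by simp
    ultimately show ?thesis by (simp add: jep_Z_def del: qStirling.simps)
  qed
  \<comment> \<open>At \<open>n = m\<close> the index \<open>k\<close> is 0 and the right side
    vanishes because \<open>qnum (1 / q) 0 = 0\<close>. There the truncated
    \<open>m - Suc n + 1\<close> would be 1 instead of 0, hence the guard.\<close>
  have Z3': "(if n < m then q ^ Suc n * jep_Z m (Suc n) q else 0) = q ^ n * (e * qStirling (1 / q) (Suc m) k)"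
  proof (cases "n < m")
    case True
    then show ?thesis using Z3 by (simp add: algebra_simps)
  next
    case False
    then have "k = 0" using m by simp
    then show ?thesis by (simp add: qnum_def m)
  qed
  \<comment> \<open>Of \<open>q ^ m = q ^ n * q ^ k\<close>, the factor \<open>q ^ k\<close> cancels
    \<open>(1 / q) ^ k\<close> in the first term and turns \<open>qnum (1 / q)\<close> into
    \<open>qnum q\<close> in the second.\<close>
  have "q ^ m * qStirling (1 / q) (Suc (Suc m)) (Suc k) =
      q ^ n * (q ^ k * (1 / q) ^ k) * qStirling (1 / q) (Suc m) k +
      q ^ n * (q ^ k * qnum (1 / q) (Suc k)) * qStirling (1 / q) (Suc m) (Suc k)"
    unfolding qStirling.simps(4)[of _ "Suc m"] by (simp add: m power_add algebra_simps del: qStirling.simps)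
  also have "\<dots> = q ^ n * qStirling (1 / q) (Suc m) k + q ^ n * qnum q (Suc k) * qStirling (1 / q) (Suc m) (Suc k)"
    using assms by (simp add: qnum_inverse power_one_over del: qStirling.simps)
  finally have "q ^ m * qStirling (1 / q) (Suc (Suc m)) (Suc k) = \<dots>" .
  then show ?thesis
    unfolding Z1 Z2 Z3' by (simp add: m algebra_simps del: qStirling.simps)
qed

text \<open>On the diagonal the Stirling number is the product of \<open>(1 / q) ^ b\<close> over
  \<open>b \<le> m\<close>, which the prefactor \<open>q ^ (Suc m choose 2)\<close> cancels. The
  induction strips off one factor at a time.\<close>

lemma jep_Z_0:
  assumes "0 < q"
  shows "jep_Z m 0 q = 1"
proof (induction m)
  case 0
  then show ?case by (simp add: jep_Z_def qnum_def binomial_eq_0)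
next
  case (Suc m)
  have ch: "(Suc (Suc m)) choose 2 = (Suc m choose 2) + Suc m"
    by (simp add: numeral_2_eq_2)
  have "jep_Z (Suc m) 0 q = q ^ (Suc m choose 2) * q ^ Suc m * qStirling (1 / q) (Suc (Suc m)) (Suc (Suc m))"
    unfolding jep_Z_def using ch by (simp add: power_int_def nat_add_distrib power_add del: binomial_Suc_Suc)
  also have "\<dots> = q ^ (Suc m choose 2) * (q ^ Suc m * (1 / q) ^ Suc m) * qStirling (1 / q) (Suc m) (Suc m)"
    by (subst qStirling.simps) (simp add: qStirling_eq_0 del: qStirling.simps binomial_Suc_Suc)
  also have "\<dots> = jep_Z m 0 q"
    unfolding jep_Z_def using assms by (simp add: power_one_over del: qStirling.simps binomial_Suc_Suc)
  finally show ?case using Suc by simp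
qed

text \<open>Both sides satisfy the same recursion in \<open>m\<close> and equal 1 at
  \<open>n = 0\<close>. When more particles than heights occur in it, the empty sum matches the
  guard in \<open>jep_Z_Suc\<close>.\<close>

lemma sum_jep_weight:
  assumes "0 < q" "q < 1" "n \<le> m"
  shows "(\<Sum>B\<in>jep_states m n. jep_weight q m B) = jep_Z m n q"
  using assms(3)
proof (induction m arbitrary: n)
  case 0
  then show ?case using assms by (simp add: jep_states_0 jep_weight_def jep_Z_0)
next
  case (Suc m)
  show ?case
  proof (cases n)
    case 0
    then show ?thesis using assms by (simp add: jep_states_0 jep_weight_def jep_Z_0)
  next
    case (Suc k)
    then have "k \<le> m" using Suc.prems by simp
    then show ?thesis using Suc.IH[of k] Suc.IH[of n] assms
      by (simp add: Suc sum_jep_weight_Suc jep_Z_Suc jep_states_empty)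
  qed
qed

section \<open>The balance identity for the weights\<close>

text \<open>The number of gaps below a site is the draw that fills it. The shift puts the site 0
  below, which is one more gap unless it is occupied.\<close>

lemma card_Diff_Suc_image:
  "card ({..<Suc c} - Suc ` B) = Suc (card ({..<c} - B))"
  "card ({..<Suc c} - insert 0 (Suc ` B)) = card ({..<c} - B)"
proof -
  have "{..<Suc c} - Suc ` B = insert 0 (Suc ` ({..<c} - B))"
    "{..<Suc c} - insert 0 (Suc ` B) = Suc ` ({..<c} - B)"
    by (rule set_eqI, rename_tac y, case_tac y; auto simp: inj_image_mem_iff)+
  then show "card ({..<Suc c} - Suc ` B) = Suc (card ({..<c} - B))"
    "card ({..<Suc c} - insert 0 (Suc ` B)) = card ({..<c} - B)"
    by (simp_all add: card_image)
qed

text \<open>Extension by 0 to sets that do not fit below \<open>m\<close>, so that the balance sum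
  can run over all \<open>b\<close> in \<open>B\<close>: if \<open>B\<close> contains the top
  height, \<open>B + 1\<close> is not a state and only the removal of that top particle yields a
  predecessor.\<close>

definition jep_weight0 :: "real \<Rightarrow> nat \<Rightarrow> nat set \<Rightarrow> real" where
  "jep_weight0 q m B = (if B \<subseteq> {0..<m} then jep_weight q m B else 0)"

lemma jep_weight0_Suc:
  "jep_weight0 q (Suc m) (Suc ` B) = q ^ card B * jep_weight0 q m B"
  "jep_weight0 q (Suc m) (insert 0 (Suc ` B)) =
    qnum q (Suc (m - card B)) * q ^ card B * jep_weight0 q m B"
  by (auto simp: jep_weight0_def jep_weight_Suc_image jep_weight_insert_0)

(* The terms on the right belong to the predecessors of B; the one for b comes from the draw
   card ({..<b} - B), whose probability has a normalising factor that cancels against the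
   factor of the predecessor at 0. *)
lemma jep_weight_balance:
  assumes "q \<noteq> 1" "B \<subseteq> {0..<Suc m}"
  shows "jep_weight q (Suc m) B = q ^ card B * jep_weight0 q m B +
    (\<Sum>b\<in>B. q ^ card ({..<b} - B) * q ^ card (B - {b}) * jep_weight0 q m (B - {b}))"
  using assms(2)
proof (induction m arbitrary: B)
  case 0
  then consider "B = {}" | "B = {0}" by fastforce
  then show ?case
  proof cases
    case 1
    then show ?thesis by (simp add: jep_weight_def jep_weight0_def)
  next
    case 2
    then show ?thesis using assms(1) by (simp add: jep_weight_def jep_weight0_def jep_v_def qnum_def)
  qed
next
  case (Suc m)
  show ?case
  proof (cases B rule: Suc_image_or_insert_0)
    case (1 C)
    then have C: "C \<subseteq> {0..<Suc m}" using Suc.prems by auto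
    then have fin: "finite C" using finite_subset by blast
    \<comment> \<open>Each term gains \<open>q ^ card C\<close>: one \<open>q\<close> for the new
      gap at 0 and \<open>q ^ card (C - {c})\<close> from the shifted weight. The whole identity for
      \<open>C\<close> is thus multiplied by \<open>q ^ card C\<close>.\<close>
    have "(\<Sum>b\<in>B. q ^ card ({..<b} - B) * q ^ card (B - {b}) * jep_weight0 q (Suc m) (B - {b})) =
      (\<Sum>c\<in>C. q ^ card C * (q ^ card ({..<c} - C) * q ^ card (C - {c}) * jep_weight0 q m (C - {c})))"
    proof -
      have *: "Suc ` C - {Suc c} = Suc ` (C - {c})" for c by auto
      have **: "q ^ card C = q * q ^ card (C - {c})" if "c \<in> C" for c
        using that fin by (metis card_Suc_Diff1 power_Suc)
      show ?thesis unfolding 1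
        by (subst sum.reindex)
          (auto intro!: sum.cong simp: * ** card_Diff_Suc_image card_image jep_weight0_Suc)
    qed
    moreover have "jep_weight q (Suc (Suc m)) B = q ^ card C * jep_weight q (Suc m) C"
      by (simp add: 1 jep_weight_Suc_image)
    ultimately show ?thesis
      unfolding Suc.IH[OF C]
      by (simp add: 1 card_image jep_weight0_Suc sum_distrib_left algebra_simps)
  next
    case (2 C)
    then have C: "C \<subseteq> {0..<Suc m}" using Suc.prems by auto
    then have fin: "finite C" using finite_subset by blast
    let ?l = "qnum q (Suc (Suc m - card C))"
    have e: "insert 0 (Suc ` C) - {0} = Suc ` C" by auto
    have "(\<Sum>b\<in>B. q ^ card ({..<b} - B) * q ^ card (B - {b}) * jep_weight0 q (Suc m) (B - {b})) =
      q ^ card C * q ^ card C * jep_weight0 q m C +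
      (\<Sum>c\<in>C. ?l * q ^ card C * (q ^ card ({..<c} - C) * q ^ card (C - {c}) * jep_weight0 q m (C - {c})))"
    proof -
      \<comment> \<open>Removing \<open>Suc c\<close> keeps the particle at 0, and its factor is
        again \<open>?l\<close>, since one particle and one height disappear together.\<close>
      have shifted: "q ^ card ({..<Suc c} - B) * q ^ card (B - {Suc c}) * jep_weight0 q (Suc m) (B - {Suc c}) =
        ?l * q ^ card C * (q ^ card ({..<c} - C) * q ^ card (C - {c}) * jep_weight0 q m (C - {c}))"
        if "c \<in> C" for c
      proof -
        define D where "D = C - {c}"
        have D: "B - {Suc c} = insert 0 (Suc ` D)" unfolding 2 D_def by auto
        have "card C = Suc (card D)" "finite D"
          unfolding D_def using card.remove[OF fin that] fin by simp_all
        then show ?thesis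
          unfolding D D_def[symmetric] unfolding 2
          by (simp add: card_Diff_Suc_image card_image jep_weight0_Suc)
      qed
      have "(\<Sum>b\<in>B. q ^ card ({..<b} - B) * q ^ card (B - {b}) * jep_weight0 q (Suc m) (B - {b})) =
        q ^ card ({..<0} - B) * q ^ card (B - {0}) * jep_weight0 q (Suc m) (B - {0}) +
        (\<Sum>c\<in>C. q ^ card ({..<Suc c} - B) * q ^ card (B - {Suc c}) * jep_weight0 q (Suc m) (B - {Suc c}))"
        (is "sum ?g B = _")
      proof -
        have "sum ?g B = ?g 0 + sum ?g (Suc ` C)" unfolding 2 using fin by (intro sum.insert) auto
        also have "sum ?g (Suc ` C) = sum (?g \<circ> Suc) C" by (rule sum.reindex) simp
        finally show ?thesis by (simp only: comp_def)
      qed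
      moreover have "B - {0} = Suc ` C" unfolding 2 by (rule e)
      ultimately show ?thesis
        by (simp add: shifted card_image jep_weight0_Suc)
    qed
    moreover have "jep_weight q (Suc (Suc m)) B = ?l * q ^ card C * jep_weight q (Suc m) C"
      using C by (simp add: 2 jep_weight_insert_0)
    \<comment> \<open>The two terms not covered by the induction hypothesis, the pure shift and the
      removal of 0, merge by \<open>[k + 1] = 1 + q [k]\<close>; the extra \<open>q\<close> comes
      from \<open>card B = card C + 1\<close>.\<close>
    moreover have "q ^ card B * jep_weight0 q (Suc m) B + q ^ card C * q ^ card C * jep_weight0 q m C =
      ?l * q ^ card C * (q ^ card C * jep_weight0 q m C)"
    proof (cases "C \<subseteq> {0..<m}")
      case True
      then have "card C \<le> m" using card_mono[of "{0..<m}" C] by simp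
      then have "?l = 1 + q * qnum q (Suc (m - card C))"
        using qnum_Suc[OF assms(1)] by (simp add: Suc_diff_le)
      then show ?thesis using fin by (simp add: 2 card_image jep_weight0_Suc algebra_simps)
    next
      case False
      then show ?thesis unfolding 2 jep_weight0_Suc by (simp add: jep_weight0_def)
    qed
    ultimately show ?thesis
      unfolding Suc.IH[OF C] by (simp add: sum_distrib_left algebra_simps)
  qed
qed

section \<open>The update map and the sites filled by the draws\<close>

text \<open>By monotonicity the free sites below \<open>theta C k\<close> are the images of the
  indices below \<open>k\<close>. Hence the draw can be read off from the site it fills.\<close>

lemma card_below_theta:
  assumes "finite C"
  shows "card ({..<theta C k} - C) = k"
proof -
  have "{..<theta C k} - C = theta C ` {..<k}"
  proof (rule set_eqI)
    fix x
    have "x \<notin> C \<longleftrightarrow> (\<exists>j. x = theta C j)"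
      using theta_bij[OF assms] unfolding bij_betw_def image_def by blast
    then show "x \<in> {..<theta C k} - C \<longleftrightarrow> x \<in> theta C ` {..<k}"
      by (auto simp: strict_mono_less[OF theta_strict_mono[OF assms]])
  qed
  moreover have "inj_on (theta C) {..<k}"
    using theta_bij[OF assms] by (auto simp: bij_betw_def intro: inj_on_subset)
  ultimately show ?thesis by (simp add: card_image)
qed

text \<open>A value above \<open>m\<close> would have all \<open>Suc (m - card C)\<close> free sites
  up to \<open>m\<close> below it, but only \<open>k\<close> free sites lie below
  \<open>theta C k\<close>. Injectivity and counting then give surjectivity.\<close>

lemma theta_bij_betw:
  assumes "C \<subseteq> {0..<m}"
  shows "bij_betw (theta C) {..<Suc (m - card C)} ({..<Suc m} - C)"
proof -
  have fin: "finite C" using assms finite_subset by blast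
  have inj: "inj_on (theta C) {..<Suc (m - card C)}"
    using theta_bij[OF fin] by (auto simp: bij_betw_def intro: inj_on_subset)
  have le: "card C \<le> m" using assms card_mono[of "{0..<m}" C] by simp
  have cd: "card ({..<Suc m} - C) = Suc (m - card C)"
    using assms fin le by (subst card_Diff_subset) (auto simp: Suc_diff_le)
  have "theta C k \<in> {..<Suc m} - C" if "k < Suc (m - card C)" for k
  proof -
    have "theta C k \<notin> C" using theta_bij[OF fin] by (auto simp: bij_betw_def)
    moreover have "theta C k < Suc m"
    proof (rule ccontr)
      assume "\<not> theta C k < Suc m"
      then have "card ({..<Suc m} - C) \<le> card ({..<theta C k} - C)"
        by (intro card_mono) auto
      then show False using that cd card_below_theta[OF fin] by simp
    qed
    ultimately show ?thesis by simp
  qed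
  then have "theta C ` {..<Suc (m - card C)} \<subseteq> {..<Suc m} - C" by blast
  moreover have "card (theta C ` {..<Suc (m - card C)}) = card ({..<Suc m} - C)"
    using card_image[OF inj] cd by simp
  ultimately have "theta C ` {..<Suc (m - card C)} = {..<Suc m} - C"
    by (intro card_subset_eq) auto
  then show ?thesis using inj by (simp add: bij_betw_def)
qed

lemma shift_down_Suc: "shift_down (Suc ` C) = C"
  by (simp add: shift_down_def image_image)

lemma jep_update_Suc: "jep_update (Suc ` C) k = C"
  by (auto simp: jep_update_def shift_down_Suc)

lemma jep_update_insert_0: "jep_update (insert 0 (Suc ` C)) k = insert (theta C k) C"
proof -
  have "insert 0 (Suc ` C) - {0} = Suc ` C" by auto
  then show ?thesis by (simp add: jep_update_def shift_down_Suc)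
qed

lemma jep_update_states:
  assumes "X \<in> jep_states (Suc m) (Suc n)" "k < Suc (m - n)"
  shows "jep_update X k \<in> jep_states (Suc m) (Suc n)"
proof -
  consider C where "X = Suc ` C" "C \<in> jep_states m (Suc n)"
    | C where "X = insert 0 (Suc ` C)" "C \<in> jep_states m n"
    using assms(1) unfolding jep_states_Suc by blast
  then show ?thesis
  proof cases
    case 1
    then show ?thesis by (auto simp: jep_update_Suc jep_states_def)
  next
    case 2
    then have C: "C \<subseteq> {0..<m}" "card C = n" and fin: "finite C"
      using 2 jep_states_finite[OF 2(2)] by (auto simp: jep_states_def)
    have "theta C k \<in> {..<Suc m} - C"
      using theta_bij_betw[OF C(1)] assms(2) C(2) by (auto simp: bij_betw_def)
    then show ?thesis using C fin 2(1) by (auto simp: jep_update_insert_0 jep_states_def)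
  qed
qed

section \<open>The transition kernel and invariance of the weights\<close>

text \<open>The normalising constant \<open>(1 - q) / (1 - q ^ l)\<close> is the reciprocal of
  \<open>qnum q l\<close>, here with \<open>l = Suc (m - n)\<close>.\<close>

lemma pmf_jep_kernel:
  assumes "0 < q" "q < 1"
  shows "pmf (jep_kernel m n q X) B =
    (\<Sum>k<Suc (m - n). q ^ k / qnum q (Suc (m - n)) * of_bool (jep_update X k = B))"
proof -
  let ?T = "trunc_geom_pmf q (Suc (m - n))"
  have T: "pmf ?T k = (if k < Suc (m - n) then q ^ k / qnum q (Suc (m - n)) else 0)" for k
    using pmf_trunc_geom[OF assms, of "Suc (m - n)" k] by (simp add: qnum_def)
  then have sub: "set_pmf ?T \<subseteq> {..<Suc (m - n)}"
    by (metis lessThan_iff pmf_eq_0_set_pmf subsetI)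
  have "pmf (jep_kernel m n q X) B = measure_pmf.expectation ?T (\<lambda>k. pmf (return_pmf (jep_update X k)) B)"
    unfolding jep_kernel_def map_pmf_def by (simp add: pmf_bind)
  also have "\<dots> = (\<Sum>k<Suc (m - n). pmf (return_pmf (jep_update X k)) B * pmf ?T k)"
    using sub by (intro integral_measure_pmf_real) (auto)
  also have "\<dots> = (\<Sum>k<Suc (m - n). q ^ k / qnum q (Suc (m - n)) * of_bool (jep_update X k = B))"
    by (intro sum.cong) (auto simp: T indicator_def)
  finally show ?thesis .
qed

lemma set_pmf_jep_kernel:
  assumes "0 < q" "q < 1"
  shows "set_pmf (jep_kernel m n q X) = jep_update X ` {..<Suc (m - n)}"
proof -
  have "pmf (trunc_geom_pmf q (Suc (m - n))) k \<noteq> 0 \<longleftrightarrow> k < Suc (m - n)" for k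
    using pmf_trunc_geom[OF assms, of "Suc (m - n)" k] assms power_less_one_iff[of q "Suc (m - n)"]
    by (auto simp del: power_Suc)
  then have "set_pmf (trunc_geom_pmf q (Suc (m - n))) = {..<Suc (m - n)}"
    by (auto simp: set_pmf_eq)
  then show ?thesis unfolding jep_kernel_def by simp
qed

text \<open>A source without a particle at 0 must be \<open>B + 1\<close>, and one with a particle
  at 0 must be \<open>{0} \<union> ((B - {b}) + 1)\<close> for some \<open>b\<close> in
  \<open>B\<close>. Regrouping the sum over sources by \<open>b\<close> leads to
  \<open>jep_weight_balance\<close>.\<close>

lemma jep_kernel_balance:
  assumes "0 < q" "q < 1" "B \<in> jep_states (Suc m) (Suc n)"
  shows "(\<Sum>X\<in>jep_states (Suc m) (Suc n). jep_weight q (Suc m) X * pmf (jep_kernel (Suc m) (Suc n) q X) B)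
    = jep_weight q (Suc m) B"
proof -
  let ?l = "qnum q (Suc (m - n))"
  have l: "?l > 0" using assms by (simp add: qnum_pos)
  have B: "B \<subseteq> {0..<Suc m}" "card B = Suc n" "finite B"
    using assms(3) jep_states_finite[OF assms(3)] by (auto simp: jep_states_def)
  have tot: "(\<Sum>k<Suc (m - n). q ^ k / ?l) = 1"
  proof -
    have "(\<Sum>k<Suc (m - n). q ^ k) = ?l"
      using assms unfolding qnum_def by (subst sum_gp_strict) simp
    then show ?thesis using l by (simp flip: sum_divide_distrib)
  qed
  have fst: "jep_weight q (Suc m) (Suc ` C) * pmf (jep_kernel (Suc m) (Suc n) q (Suc ` C)) B =
      (if C = B then q ^ Suc n * jep_weight q m B else 0)" if "C \<in> jep_states m (Suc n)" for C
  proof -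
    have "pmf (jep_kernel (Suc m) (Suc n) q (Suc ` C)) B = of_bool (C = B)"
      using tot by (simp add: pmf_jep_kernel[OF assms(1,2)] jep_update_Suc del: sum.lessThan_Suc)
    then show ?thesis using that by (auto simp: jep_weight_Suc_image jep_states_def)
  qed
  have snd: "jep_weight q (Suc m) (insert 0 (Suc ` C)) *
        pmf (jep_kernel (Suc m) (Suc n) q (insert 0 (Suc ` C))) B =
      (\<Sum>b\<in>B. if C = B - {b} then q ^ card ({..<b} - B) * q ^ n * jep_weight q m C else 0)"
    if "C \<in> jep_states m n" for C
  proof -
    have C: "C \<subseteq> {0..<m}" "card C = n" "finite C"
      using that jep_states_finite[OF that] by (auto simp: jep_states_def)
    have "?l * pmf (jep_kernel (Suc m) (Suc n) q (insert 0 (Suc ` C))) B =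
        (\<Sum>k<Suc (m - n). q ^ card ({..<theta C k} - C) * of_bool (insert (theta C k) C = B))"
      using l by (simp add: pmf_jep_kernel[OF assms(1,2)] jep_update_insert_0 sum_distrib_left
          card_below_theta[OF C(3)] del: sum.lessThan_Suc)
    \<comment> \<open>Change of variables from the draw \<open>k\<close> to the landing site
      \<open>b = theta C k\<close>.\<close>
    also have "\<dots> = (\<Sum>b\<in>{..<Suc m} - C. q ^ card ({..<b} - C) * of_bool (insert b C = B))"
      using sum.reindex_bij_betw[OF theta_bij_betw[OF C(1)],
          of "\<lambda>b. q ^ card ({..<b} - C) * of_bool (insert b C = B)"] C(2) by simp
    also have "\<dots> = (\<Sum>b\<in>{b\<in>{..<Suc m} - C. insert b C = B}. q ^ card ({..<b} - C))"
      by (subst sum.inter_filter) (simp_all add: of_bool_def if_distrib cong: if_cong)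
    also have "{b\<in>{..<Suc m} - C. insert b C = B} = {b\<in>B. C = B - {b}}"
      using B by auto
    \<comment> \<open>\<open>B\<close> and \<open>C\<close> differ only in \<open>b\<close> itself,
      so they have the same gaps below \<open>b\<close>.\<close>
    also have "(\<Sum>b\<in>{b\<in>B. C = B - {b}}. q ^ card ({..<b} - C)) =
        (\<Sum>b\<in>{b\<in>B. C = B - {b}}. q ^ card ({..<b} - B))"
    proof (rule sum.cong[OF refl])
      fix b assume "b \<in> {b\<in>B. C = B - {b}}"
      then have "{..<b} - C = {..<b} - B" by auto
      then show "q ^ card ({..<b} - C) = q ^ card ({..<b} - B)" by simp
    qed
    also have "\<dots> = (\<Sum>b\<in>B. if C = B - {b} then q ^ card ({..<b} - B) else 0)"
      using B(3) by (rule sum.inter_filter)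
    finally have *: "?l * pmf (jep_kernel (Suc m) (Suc n) q (insert 0 (Suc ` C))) B = \<dots>" .
    have "jep_weight q (Suc m) (insert 0 (Suc ` C)) *
        pmf (jep_kernel (Suc m) (Suc n) q (insert 0 (Suc ` C))) B =
      q ^ n * jep_weight q m C * (?l * pmf (jep_kernel (Suc m) (Suc n) q (insert 0 (Suc ` C))) B)"
      using C by (simp add: jep_weight_insert_0)
    then show ?thesis unfolding * by (simp add: sum_distrib_left if_distrib algebra_simps cong: if_cong)
  qed
  have "(\<Sum>C\<in>jep_states m (Suc n). if C = B then q ^ Suc n * jep_weight q m B else 0) =
      q ^ card B * jep_weight0 q m B"
    using B by (auto simp: finite_jep_states jep_weight0_def jep_states_def)
  moreover have "(\<Sum>C\<in>jep_states m n. \<Sum>b\<in>B.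
        if C = B - {b} then q ^ card ({..<b} - B) * q ^ n * jep_weight q m C else 0) =
      (\<Sum>b\<in>B. q ^ card ({..<b} - B) * q ^ card (B - {b}) * jep_weight0 q m (B - {b}))"
  proof (subst sum.swap, rule sum.cong[OF refl])
    fix b assume "b \<in> B"
    then have c: "card (B - {b}) = n" using B by simp
    have "(\<Sum>C\<in>jep_states m n. if C = B - {b} then q ^ card ({..<b} - B) * q ^ n * jep_weight q m C else 0) =
      (\<Sum>C\<in>jep_states m n. if C = B - {b} then q ^ card ({..<b} - B) * q ^ n * jep_weight q m (B - {b}) else 0)"
      by (rule sum.cong) auto
    also have "\<dots> = q ^ card ({..<b} - B) * q ^ card (B - {b}) * jep_weight0 q m (B - {b})"
      using c by (auto simp: finite_jep_states jep_weight0_def jep_states_def)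
    finally show "(\<Sum>C\<in>jep_states m n. if C = B - {b} then q ^ card ({..<b} - B) * q ^ n * jep_weight q m C else 0) =
      q ^ card ({..<b} - B) * q ^ card (B - {b}) * jep_weight0 q m (B - {b})" .
  qed
  ultimately show ?thesis
    using jep_weight_balance[of q B m] assms B by (simp add: sum_jep_states_Suc fst snd)
qed

section \<open>Uniqueness of the stationary law of a finite chain\<close>

lemma pmf_bind_finite:
  assumes "finite S" "set_pmf p \<subseteq> S"
  shows "pmf (bind_pmf p K) y = (\<Sum>x\<in>S. pmf p x * pmf (K x) y)"
  using assms unfolding pmf_bind
  by (subst integral_measure_pmf_real[of S]) (auto simp: mult.commute)

text \<open>Each \<open>K x\<close> has mass 1 on \<open>S\<close>, so summing the inequalities over
  \<open>y\<close> gives equal totals and each of them is an equality. Zeros then pass backwards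
  along transitions, from \<open>s\<close> to all of \<open>S\<close> by induction on
  \<open>rk\<close>.\<close>

lemma subinvariant_eq_0:
  fixes K :: "'a \<Rightarrow> 'a pmf" and h :: "'a \<Rightarrow> real" and rk :: "'a \<Rightarrow> nat"
  assumes fin: "finite S" and closed: "\<And>x. x \<in> S \<Longrightarrow> set_pmf (K x) \<subseteq> S"
    and down: "\<And>x. x \<in> S \<Longrightarrow> x \<noteq> s \<Longrightarrow> \<exists>y\<in>set_pmf (K x). rk y < rk x"
    and nonneg: "\<And>x. x \<in> S \<Longrightarrow> 0 \<le> h x"
    and sub: "\<And>y. y \<in> S \<Longrightarrow> h y \<le> (\<Sum>x\<in>S. h x * pmf (K x) y)"
    and s: "h s = 0" and x: "x \<in> S"
  shows "h x = 0"
proof -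
  have "(\<Sum>y\<in>S. \<Sum>x\<in>S. h x * pmf (K x) y) = (\<Sum>x\<in>S. h x * (\<Sum>y\<in>S. pmf (K x) y))"
    by (subst sum.swap) (simp add: sum_distrib_left)
  also have "\<dots> = (\<Sum>x\<in>S. h x)"
    using sum_pmf_eq_1[OF fin closed] by simp
  finally have tot: "(\<Sum>y\<in>S. (\<Sum>x\<in>S. h x * pmf (K x) y) - h y) = 0"
    by (simp add: sum_subtractf)
  have inv: "(\<Sum>x\<in>S. h x * pmf (K x) y) = h y" if "y \<in> S" for y
    using sum_nonneg_0[OF fin _ tot that] sub by simp
  show ?thesis using x
  proof (induction x rule: measure_induct_rule[of rk])
    case (less x)
    show ?case
    proof (cases "x = s")
      case False
      then obtain y where y: "y \<in> set_pmf (K x)" "rk y < rk x"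
        using down less.prems by blast
      then have yS: "y \<in> S" using closed less.prems by blast
      have "(\<Sum>x\<in>S. h x * pmf (K x) y) = 0" using inv[OF yS] less.IH[OF y(2) yS] by simp
      \<comment> \<open>One term of a vanishing sum of nonnegative terms; the other factor is
        positive because \<open>y\<close> is in the support of \<open>K x\<close>.\<close>
      then have "h x * pmf (K x) y = 0"
        by (rule sum_nonneg_0[OF fin, rotated]) (simp_all add: nonneg less.prems)
      then show ?thesis using y(1) by (simp add: set_pmf_eq)
    qed (simp add: s)
  qed
qed

text \<open>The combination of \<open>p\<close> and \<open>p'\<close> that vanishes at
  \<open>s\<close> vanishes on \<open>S\<close>, so the two laws are proportional; equal total mass
  makes them equal.\<close>

lemma stationary_unique:
  fixes K :: "'a \<Rightarrow> 'a pmf" and rk :: "'a \<Rightarrow> nat"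
  assumes fin: "finite S" and closed: "\<And>x. x \<in> S \<Longrightarrow> set_pmf (K x) \<subseteq> S"
    and down: "\<And>x. x \<in> S \<Longrightarrow> x \<noteq> s \<Longrightarrow> \<exists>y\<in>set_pmf (K x). rk y < rk x"
    and p: "set_pmf p \<subseteq> S" "bind_pmf p K = p"
    and p': "set_pmf p' \<subseteq> S" "bind_pmf p' K = p'"
  shows "p = p'"
proof -
  have inv: "pmf p y = (\<Sum>x\<in>S. pmf p x * pmf (K x) y)"
    "pmf p' y = (\<Sum>x\<in>S. pmf p' x * pmf (K x) y)" for y
    using pmf_bind_finite[OF fin p(1), of K y] pmf_bind_finite[OF fin p'(1), of K y] p(2) p'(2)
    by simp_all
  have one: "(\<Sum>x\<in>S. pmf p x) = 1" "(\<Sum>x\<in>S. pmf p' x) = 1"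
    using sum_pmf_eq_1[OF fin] p p' by blast+
  define h where "h x = pmf p' s * pmf p x - pmf p s * pmf p' x" for x
  have h_inv: "h y = (\<Sum>x\<in>S. h x * pmf (K x) y)" for y
    unfolding h_def by (subst inv(1), subst inv(2)) (simp add: sum_subtractf sum_distrib_left algebra_simps)
  have "\<bar>h x\<bar> = 0" if "x \<in> S" for x
  proof (rule subinvariant_eq_0[OF fin closed down _ _ _ that])
    show "\<bar>h y\<bar> \<le> (\<Sum>x\<in>S. \<bar>h x\<bar> * pmf (K x) y)" for y
      using sum_abs[of "\<lambda>x. h x * pmf (K x) y" S] by (simp add: abs_mult flip: h_inv)
  qed (auto simp: h_def)
  then have eq: "pmf p' s * pmf p x = pmf p s * pmf p' x" if "x \<in> S" for x
    using that by (simp add: h_def)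
  then have "(\<Sum>x\<in>S. pmf p' s * pmf p x) = (\<Sum>x\<in>S. pmf p s * pmf p' x)" by simp
  then have ss: "pmf p' s = pmf p s"
    using one by (simp flip: sum_distrib_left)
  \<comment> \<open>Otherwise \<open>pmf p\<close> itself would be a nonnegative invariant function
    vanishing at \<open>s\<close>, hence zero on \<open>S\<close>.\<close>
  have "pmf p s \<noteq> 0"
  proof
    assume z: "pmf p s = 0"
    have "pmf p x = 0" if "x \<in> S" for x
      by (rule subinvariant_eq_0[where h = "pmf p", OF fin closed down _ _ z that]) (auto simp flip: inv)
    then show False using one by simp
  qed
  have "pmf p x = pmf p' x" for x
  proof (cases "x \<in> S")
    case True
    with eq ss show ?thesis using \<open>pmf p s \<noteq> 0\<close> by simp
  next
    case False
    then have "x \<notin> set_pmf p" "x \<notin> set_pmf p'" using p(1) p'(1) by blast+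
    then show ?thesis by (simp add: set_pmf_eq)
  qed
  then show ?thesis by (rule pmf_eqI)
qed

section \<open>Descent to the lowest state and identification of the stationary law\<close>

text \<open>With 0 empty, every particle drops by one. With 0 occupied, the other \<open>n\<close>
  particles lose \<open>n\<close> in total while the thrown one lands on the least free site, which
  is at most \<open>n\<close>, with equality only if \<open>X\<close> is
  \<open>{..<Suc n}\<close>.\<close>

lemma sum_jep_update_0_less:
  assumes "X \<in> jep_states (Suc m) (Suc n)" "X \<noteq> {..<Suc n}"
  shows "\<Sum>(jep_update X 0) < \<Sum>X"
proof -
  consider C where "X = Suc ` C" "C \<in> jep_states m (Suc n)"
    | C where "X = insert 0 (Suc ` C)" "C \<in> jep_states m n"
    using assms(1) unfolding jep_states_Suc by blast
  then show ?thesis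
  proof cases
    case 1
    then have "card C = Suc n" by (simp add: jep_states_def)
    then show ?thesis using 1 by (simp add: jep_update_Suc sum.reindex sum.distrib sum_Suc)
  next
    case 2
    then have C: "card C = n" "finite C"
      using 2 jep_states_finite[OF 2(2)] by (auto simp: jep_states_def)
    have "card ({..<theta C 0} - C) = 0" using card_below_theta[OF C(2)] .
    then have sub: "{..<theta C 0} \<subseteq> C" by simp
    then have le: "theta C 0 \<le> n" using card_mono[OF C(2) sub] C(1) by simp
    moreover have "theta C 0 \<noteq> n"
    proof
      assume "theta C 0 = n"
      then have "{..<n} = C" using card_subset_eq[OF C(2) sub] C(1) by simp
      then show False using assms(2) 2(1) by (auto simp: lessThan_Suc_eq_insert_0)
    qed
    ultimately have "theta C 0 < n" by simp
    moreover have "theta C 0 \<notin> C" using theta_bij[OF C(2)] by (auto simp: bij_betw_def)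
    ultimately show ?thesis using 2 C by (simp add: jep_update_insert_0 sum.reindex sum_Suc)
  qed
qed

theorem theorem2p1:
  fixes q :: real and m n :: nat
  assumes "0 < q" and "q < 1" and "1 \<le> n" and "n \<le> m"
  shows "(\<exists>!p. jep_stationary m n q p) \<and>
    (\<forall>B. B \<subseteq> {0..<m} \<and> card B = n \<longrightarrow>
      pmf (jep_pi m n q) B
        = inverse (jep_Z m n q) * (\<Prod>x\<in>B. qnum q (1 + jep_v m B x) * q ^ x))"
proof -
  let ?S = "jep_states m n" and ?K = "jep_kernel m n q"
  obtain M N where m: "m = Suc M" and n: "n = Suc N"
    using assms(3,4) by (metis One_nat_def Suc_le_D le_trans)
  have Z: "(\<Sum>B\<in>?S. jep_weight q m B) = jep_Z m n q"
    using sum_jep_weight assms by blast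
  have "{0..<n} \<in> ?S" using assms by (auto simp: jep_states_def)
  then have Zpos: "jep_Z m n q > 0"
    unfolding Z[symmetric]
    using jep_weight_pos[OF assms(1,2)] finite_jep_states by (intro sum_pos) auto
  \<comment> \<open>The value 0 off the states makes this a mass function on all sets of naturals,
    as \<open>embed_pmf\<close> requires.\<close>
  let ?f = "\<lambda>B. if B \<in> ?S then jep_weight q m B / jep_Z m n q else 0"
  have nonneg: "0 \<le> ?f B" for B
    using jep_weight_pos[OF assms(1,2), of m B] Zpos by simp
  have sum1: "(\<Sum>B\<in>?S. ?f B) = 1"
    using Z Zpos by (simp flip: sum_divide_distrib)
  have "(\<Sum>B\<in>?S. ennreal (?f B)) = ennreal (\<Sum>B\<in>?S. ?f B)"
    by (rule sum_ennreal) (rule nonneg)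
  then have "(\<Sum>B\<in>?S. ennreal (?f B)) = 1"
    by (simp only: sum1 ennreal_1)
  then have "(\<integral>\<^sup>+ B. ennreal (?f B) \<partial>count_space UNIV) = 1"
    by (subst nn_integral_count_space'[of ?S]) (auto simp: finite_jep_states)
  then have embed: "pmf (embed_pmf ?f) B = ?f B" for B
    using pmf_embed_pmf[of ?f] nonneg by blast
  define p where "p = embed_pmf ?f"
  have pmf_p: "pmf p B = ?f B" for B
    unfolding p_def by (rule embed)
  have sub: "set_pmf p \<subseteq> ?S"
    by (auto simp: set_pmf_eq pmf_p split: if_splits)
  have closed: "set_pmf (?K X) \<subseteq> ?S" if "X \<in> ?S" for X
    using that jep_update_states by (auto simp: set_pmf_jep_kernel assms m n)
  have "bind_pmf p ?K = p"
  proof (rule pmf_eqI)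
    fix B
    have "pmf (bind_pmf p ?K) B = (\<Sum>X\<in>?S. jep_weight q m X * pmf (?K X) B) / jep_Z m n q"
      by (simp add: pmf_bind_finite[OF finite_jep_states sub] pmf_p sum_divide_distrib)
    also have "\<dots> = pmf p B"
    proof (cases "B \<in> ?S")
      case True
      then show ?thesis using jep_kernel_balance[OF assms(1,2)] by (simp add: pmf_p m n)
    next
      case False
      then have "pmf (?K X) B = 0" if "X \<in> ?S" for X
        using closed[OF that] by (auto simp: set_pmf_eq)
      then show ?thesis using False by (simp add: pmf_p)
    qed
    finally show "pmf (bind_pmf p ?K) B = pmf p B" .
  qed
  then have stat: "jep_stationary m n q p"
    using sub by (simp add: jep_stationary_def)
  \<comment> \<open>The rank is the sum of the positions and the target state is
    \<open>{..<n}\<close>; the draw 0 always has positive probability.\<close>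
  have down: "\<exists>Y\<in>set_pmf (?K X). \<Sum>Y < \<Sum>X" if "X \<in> ?S" "X \<noteq> {..<n}" for X
    using sum_jep_update_0_less[of X M N] that by (auto simp: set_pmf_jep_kernel assms m n)
  have uniq: "p' = p" if "jep_stationary m n q p'" for p'
  proof (rule stationary_unique[OF finite_jep_states closed down])
    show "set_pmf p' \<subseteq> ?S" "bind_pmf p' ?K = p'" "set_pmf p \<subseteq> ?S" "bind_pmf p ?K = p"
      using that stat by (simp_all add: jep_stationary_def)
  qed
  have "jep_pi m n q = p"
    unfolding jep_pi_def by (rule the_equality[of "jep_stationary m n q", OF stat uniq])
  then have "pmf (jep_pi m n q) B
      = inverse (jep_Z m n q) * (\<Prod>x\<in>B. qnum q (1 + jep_v m B x) * q ^ x)"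
    if "B \<subseteq> {0..<m} \<and> card B = n" for B
    using that by (simp add: pmf_p jep_states_def jep_weight_def divide_inverse_commute)
  moreover have "\<exists>!p. jep_stationary m n q p"
    by (rule ex1I[of "jep_stationary m n q", OF stat uniq])
  ultimately show ?thesis by blast
qed

end
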